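(* There is an absolute constant $C>0$ such that for every $N\ge 2$, every connected graph $\mathcal{G}=(\mathcal{V},\mathcal{E})$ with $|\mathcal{V}|=N$, and every initial assignment of votes (each node votes strong positive, strong negative, or has no vote) in which a majority opinion exists (i.e. the number of strong positive votes differs from the number of strong negative votes), the expected convergence time of the binary voting consensus algorithm on $\mathcal{G}$ is at most $C N^3\log N$. That is, the expected convergence time is $O(N^3\log N)$, uniformly over connected graphs on $N$ nodes and over initial votes.
   Context: $\mathcal{G}=(\mathcal{V},\mathcal{E})$ is a finite simple undirected connected graph with $\mathcal{V}=\{1,\dots,N\}$; $\mathcal{N}_i$ is the set of neighbors of node $i$. Clock/edge selection: time $t=0,1,2,\dots$ is discrete and counts ticks of a global clock. At each tick, independently of the past, a node $i$ is chosen uniformly at random from $\mathcal{V}$, and then $i$ chooses a neighbor $j$ uniformly at random from $\mathcal{N}_i$; edge $(i,j)$ is activated and nodes $i,j$ exchange information and update their states. All other nodes keep their states. Binary voting consensus algorithm: the state $S^{(i)}(t)$ of node $i$ at time $t$ lies in $\{S^+,S^-,W^+,W^-\}=\{+2,-2,+1,-1\}$ (strong positive, strong negative, weak positive, weak negative). Initially, a node with a vote has the corresponding strong state $\pm 2$, and a node without a vote is randomly initialized to one of the weak states $\pm1$. When edge $(i,j)$ is activated at time $t$: 1. if $S^{(i)}(t)=S^{(j)}(t)$, both states are unchanged; 2. if $|S^{(i)}(t)|>|S^{(j)}(t)|$ and $S^{(i)}(t)S^{(j)}(t)<0$, then $S^{(i)}(t+1)=-S^{(j)}(t)$ and $S^{(j)}(t+1)=S^{(i)}(t)$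 (and symmetrically with $i,j$ interchanged); 3. if $|S^{(i)}(t)|>|S^{(j)}(t)|$ and $S^{(i)}(t)S^{(j)}(t)>0$, then $S^{(i)}(t+1)=S^{(j)}(t)$ and $S^{(j)}(t+1)=S^{(i)}(t)$ (and symmetrically); 4. if $S^{(i)}(t)=-S^{(j)}(t)$, then $S^{(i)}(t+1)=\mathrm{sign}(S^{(j)}(t))$ and $S^{(j)}(t+1)=\mathrm{sign}(S^{(i)}(t))$. Convergence time: the first time $t$ at which all node states are positive or all node states are negative. *)

theory Defs
  imports "HOL-Probability.Probability" "Graph_Theory.Digraph_Component"
begin

(* A finite simple undirected graph is a pair_graph: each undirected edge {i, j} is stored as
   the two arcs (i, j) and (j, i). *)

definition neighbors :: "nat pair_pre_digraph \<Rightarrow> nat \<Rightarrow> nat set" where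
  "neighbors G i = {j. (i, j) \<in> parcs G}"

definition activation_pmf :: "nat pair_pre_digraph \<Rightarrow> (nat \<times> nat) pmf" where
  "activation_pmf G =
     bind_pmf (pmf_of_set (pverts G))
       (\<lambda>i. map_pmf (\<lambda>j. (i, j)) (pmf_of_set (neighbors G i)))"

(* Independent activations; entry t of the stream is the pair activated at time t. *)
definition clock_space :: "nat pair_pre_digraph \<Rightarrow> (nat \<times> nat) stream measure" where
  "clock_space G = stream_space (measure_pmf (activation_pmf G))"

(* States are the integers 2, -2, 1, -1. The third and fifth branches are the second and fourth
   with the two nodes interchanged; the last branch is never reached from these states. *)
definition exchange :: "int \<Rightarrow> int \<Rightarrow> int \<times> int" where
  "exchange a b =
     (if a = b then (a, b)
      else if \<bar>a\<bar> > \<bar>b\<bar> \<and> a * b < 0 then (- b, a)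
      else if \<bar>b\<bar> > \<bar>a\<bar> \<and> a * b < 0 then (b, - a)
      else if \<bar>a\<bar> > \<bar>b\<bar> \<and> a * b > 0 then (b, a)
      else if \<bar>b\<bar> > \<bar>a\<bar> \<and> a * b > 0 then (b, a)
      else if a = - b then (sgn b, sgn a)
      else (a, b))"

definition activate :: "nat \<times> nat \<Rightarrow> (nat \<Rightarrow> int) \<Rightarrow> (nat \<Rightarrow> int)" where
  "activate e S =
     (case e of (i, j) \<Rightarrow> (case exchange (S i) (S j) of (a, b) \<Rightarrow> S(i := a, j := b)))"

primrec node_states :: "(nat \<Rightarrow> int) \<Rightarrow> (nat \<times> nat) stream \<Rightarrow> nat \<Rightarrow> (nat \<Rightarrow> int)" where
  "node_states S0 \<omega> 0 = S0"
| "node_states S0 \<omega> (Suc t) = activate (\<omega> !! t) (node_states S0 \<omega> t)"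

datatype vote = Vote_Pos | Vote_Neg | No_Vote

definition majority_exists :: "nat set \<Rightarrow> (nat \<Rightarrow> vote) \<Rightarrow> bool" where
  "majority_exists V votes \<longleftrightarrow>
     card {i \<in> V. votes i = Vote_Pos} \<noteq> card {i \<in> V. votes i = Vote_Neg}"

fun initial_states :: "vote \<Rightarrow> int set" where
  "initial_states Vote_Pos = {2}"
| "initial_states Vote_Neg = {- 2}"
| "initial_states No_Vote = {1, - 1}"

(* The law of the random weak states of the nodes without a vote is left unspecified: any law of
   the initial configuration that is compatible with the votes is admitted. *)
definition initial_law :: "nat set \<Rightarrow> (nat \<Rightarrow> vote) \<Rightarrow> (nat \<Rightarrow> int) pmf \<Rightarrow> bool" where
  "initial_law V votes \<mu> \<longleftrightarrow>
     (\<forall>S0 \<in> set_pmf \<mu>. \<forall>i \<in> V. S0 i \<in> initial_states (votes i))"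

definition consensus :: "nat set \<Rightarrow> (nat \<Rightarrow> int) \<Rightarrow> bool" where
  "consensus V S \<longleftrightarrow> (\<forall>i \<in> V. S i > 0) \<or> (\<forall>i \<in> V. S i < 0)"

(* The infimum is \<infinity> if consensus is never reached. *)
definition convergence_time ::
    "nat set \<Rightarrow> (nat \<Rightarrow> int) \<Rightarrow> (nat \<times> nat) stream \<Rightarrow> enat" where
  "convergence_time V S0 \<omega> = (INF t \<in> {t. consensus V (node_states S0 \<omega> t)}. enat t)"

(* The initial configuration is independent of the activations. *)
definition expected_convergence_time ::
    "nat pair_pre_digraph \<Rightarrow> (nat \<Rightarrow> int) pmf \<Rightarrow> ennreal" where
  "expected_convergence_time G \<mu> =
     (\<integral>\<^sup>+ (S0, \<omega>). ennreal_of_enat (convergence_time (pverts G) S0 \<omega>)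
        \<partial>(measure_pmf \<mu> \<Otimes>\<^sub>M clock_space G))"

end

theory Submission
  imports Defs "HOL-Combinatorics.Transposition"
begin

text \<open>
  Every activation exchanges the opinions of two nodes, up to the weakening of two opposite strong
  opinions and the conversion of a weak opinion by an opposite strong one; so opinions are particles
  carried by random transpositions. Let \<open>u(x, y)\<close> be a potential whose expectation drops by at least
  one per step as long as particles at \<open>x\<close> and \<open>y\<close> have not met; it is obtained from Cesaro averages
  of the heat kernel of one particle, and the bound \<open>3 N\<^sup>2\<close> for the effective resistances makes it
  \<open>O(N\<^sup>3)\<close>. Summing it over all pairs of a strong negative and a strong positive opinion, and over all
  pairs of a negative and a strong positive opinion, gives a function of the configuration that is
  polynomially bounded, at least one before consensus, and contracted in mean by the factor
  \<open>1 - c / N\<^sup>3\<close> at every step. The tail of the convergence time is hence at most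
  \<open>min 1 (N\<^sup>1\<^sup>4 (1 - c / N\<^sup>3)\<^sup>t)\<close>, which sums to \<open>O(N\<^sup>3 log N)\<close>.
\<close>

section \<open>Resistances along shortest paths\<close>

text \<open>
  Every vertex is adjacent to at most three vertices of a shortest path, so the degrees along it add
  up to at most \<open>3 * card V\<close>.
\<close>

lemma shortest_path_resistance:
  fixes f :: "'a \<Rightarrow> real"
  assumes V: "finite V" "V \<noteq> {}" and E: "E \<subseteq> V \<times> V" "sym E" and xy: "(x, y) \<in> E\<^sup>*"
  shows "(f x - f y)\<^sup>2 \<le> 3 * real (card V) ^ 2 *
    (\<Sum>e\<in>E. 1 / (card V * card (E `` {fst e})) * (f (fst e) - f (snd e))\<^sup>2)"
proof -
  define k where "k = (LEAST k. (x, y) \<in> E ^^ k)"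
  have "\<exists>k. (x, y) \<in> E ^^ k"
    using xy by (simp add: rtrancl_power)
  then have "(x, y) \<in> E ^^ k"
    unfolding k_def by (rule LeastI_ex)
  then obtain v where v: "v 0 = x" "v k = y" "\<And>i. i < k \<Longrightarrow> (v i, v (Suc i)) \<in> E"
    unfolding relpow_fun_conv by blast
  \<comment> \<open>A shortcut of \<open>m\<close> steps from \<open>v i\<close> to
    \<open>v j\<close> gives a walk of \<open>i + m + (k - j)\<close> steps from \<open>x\<close> to
    \<open>y\<close>, which the minimality of \<open>k\<close> forbids to be shorter than
    \<open>k\<close>.\<close>
  have min: "j \<le> i + m" if "(v i, v j) \<in> E ^^ m" "i \<le> k" "j \<le> k" for i j m
  proof -
    have "(x, v i) \<in> E ^^ i"
      unfolding relpow_fun_conv using v that by (intro exI[of _ v]) auto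
    moreover have "(v j, y) \<in> E ^^ (k - j)"
      unfolding relpow_fun_conv using v that by (intro exI[of _ "\<lambda>l. v (j + l)"]) auto
    ultimately have "(x, y) \<in> E ^^ (i + m + (k - j))"
      using that(1) by (auto simp: relpow_add)
    then have "k \<le> i + m + (k - j)"
      unfolding k_def by (rule Least_le)
    then show ?thesis
      using that by simp
  qed
  have inj: "inj_on v {..k}"
  proof (rule inj_onI)
    fix i j assume "i \<in> {..k}" "j \<in> {..k}" "v i = v j"
    then show "i = j"
      using min[of i j 0] min[of j i 0] by simp
  qed
  have adj: "card {i. i < k \<and> (v i, u) \<in> E} \<le> 3" for u
  proof (cases "{i. i < k \<and> (v i, u) \<in> E} = {}")
    case False
    define I where "I = {i. i < k \<and> (v i, u) \<in> E}"
    have fin: "finite I"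
      by (simp add: I_def)
    then have "Min I \<in> I"
      using False by (intro Min_in) (auto simp: I_def)
    \<comment> \<open>Two path vertices adjacent to \<open>u\<close> are two steps apart through
      \<open>u\<close>, so their indices differ by at most 2.\<close>
    have "I \<subseteq> {Min I..Min I + 2}"
    proof
      fix j assume j: "j \<in> I"
      have "(v (Min I), u) \<in> E" "(u, v j) \<in> E"
        using j \<open>Min I \<in> I\<close> E(2) by (auto simp: I_def dest: symD)
      then have "(v (Min I), v j) \<in> E ^^ 2"
        by (auto simp: numeral_2_eq_2)
      then show "j \<in> {Min I..Min I + 2}"
        using min[of "Min I" j 2] j \<open>Min I \<in> I\<close> fin by (auto simp: I_def)
    qed
    then have "card I \<le> card {Min I..Min I + 2}"
      by (intro card_mono) auto
    then show ?thesis
      by (simp add: I_def)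
  next
    case True
    show ?thesis
      unfolding True by simp
  qed
  define N where "N = real (card V)"
  have N: "N > 0"
    using V by (simp add: N_def card_gt_0_iff)
  define d where "d w = real (card (E `` {w}))" for w
  have finE: "finite E"
    using V E by (meson finite_SigmaI finite_subset)
  have d_pos: "d (v i) > 0" if "i < k" for i
    using v(3)[OF that] finE by (auto simp: d_def card_gt_0_iff intro: finite_Image)
  \<comment> \<open>Double counting: the degrees along the path are counted from the side of the
    neighbours \<open>u\<close>.\<close>
  have "(\<Sum>i<k. d (v i)) = (\<Sum>i<k. \<Sum>u\<in>V. of_bool ((v i, u) \<in> E))"
  proof (rule sum.cong[OF refl])
    fix i
    have "E `` {v i} = V \<inter> {u. (v i, u) \<in> E}"
      using E by auto
    then show "d (v i) = (\<Sum>u\<in>V. of_bool ((v i, u) \<in> E))"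
      using V by (simp add: d_def sum_of_bool_eq)
  qed
  also have "\<dots> = (\<Sum>u\<in>V. \<Sum>i<k. of_bool ((v i, u) \<in> E))"
    by (rule sum.swap)
  also have "\<dots> \<le> (\<Sum>u\<in>V. 3)"
  proof (rule sum_mono)
    fix u
    have "(\<Sum>i<k. of_bool ((v i, u) \<in> E)) = real (card {i. i < k \<and> (v i, u) \<in> E})"
      by (simp add: sum_of_bool_eq lessThan_def Collect_conj_eq)
    then show "(\<Sum>i<k. of_bool ((v i, u) \<in> E)) \<le> (3 :: real)"
      using adj[of u] by simp
  qed
  finally have sum_d: "(\<Sum>i<k. d (v i)) \<le> 3 * N"
    by (simp add: N_def)
  define D where "D i = f (v i) - f (v (Suc i))" for i
  have "f x - f y = (\<Sum>i<k. D i)"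
    using sum_lessThan_telescope'[of "\<lambda>i. f (v i)" k] v by (simp add: D_def)
  \<comment> \<open>Prepares Cauchy-Schwarz with the reciprocals \<open>N * d (v i)\<close> of the
    arc conductances as weights. They add up to at most \<open>3 * N\<^sup>2\<close>; the other
    factor is the part of the energy carried by the arcs of the path, which are distinct because
    \<open>v\<close> is injective.\<close>
  also have "\<dots> = (\<Sum>i<k. sqrt (N * d (v i)) * (D i / sqrt (N * d (v i))))"
    using d_pos N by (intro sum.cong) (auto simp: less_le)
  finally have "(f x - f y)\<^sup>2
      \<le> (\<Sum>i<k. (sqrt (N * d (v i)))\<^sup>2) * (\<Sum>i<k. (D i / sqrt (N * d (v i)))\<^sup>2)"
    using Cauchy_Schwarz_ineq_sum[of "\<lambda>i. sqrt (N * d (v i))" "\<lambda>i. D i / sqrt (N * d (v i))" "{..<k}"]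
    by simp
  also have "(\<Sum>i<k. (sqrt (N * d (v i)))\<^sup>2) = N * (\<Sum>i<k. d (v i))"
    using d_pos N by (simp add: sum_distrib_left less_imp_le)
  also have "(\<Sum>i<k. (D i / sqrt (N * d (v i)))\<^sup>2) = (\<Sum>i<k. 1 / (N * d (v i)) * (D i)\<^sup>2)"
    using d_pos N by (intro sum.cong) (auto simp: power_divide less_imp_le)
  also have "\<dots> = (\<Sum>e\<in>(\<lambda>i. (v i, v (Suc i))) ` {..<k}. 1 / (N * d (fst e)) * (f (fst e) - f (snd e))\<^sup>2)"
    using inj by (subst sum.reindex) (auto simp: D_def inj_on_def)
  also have "\<dots> \<le> (\<Sum>e\<in>E. 1 / (N * d (fst e)) * (f (fst e) - f (snd e))\<^sup>2)" (is "_ \<le> ?e")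
    using finE v N by (intro sum_mono2) (auto simp: d_def)
  also have "N * (\<Sum>i<k. d (v i)) * ?e \<le> N * (3 * N) * ?e"
    using sum_d N by (intro mult_right_mono mult_left_mono sum_nonneg) (auto simp: d_def)
  finally show ?thesis
    using N d_pos by (simp add: power2_eq_square N_def d_def mult_left_mono sum_nonneg)
qed

section \<open>Meeting of two randomly transported particles\<close>

definition swap :: "'a \<times> 'a \<Rightarrow> 'a \<Rightarrow> 'a" where
  "swap e = Transposition.transpose (fst e) (snd e)"

lemma swap_swap [simp]: "swap e (swap e x) = x"
  by (simp add: swap_def)

lemma inj_swap: "inj (swap e)"
  by (metis injI swap_swap)

text \<open>
  The particles of the voting process are carried around by random transpositions; \<open>R\<close> bounds the
  effective resistance of the network with conductances \<open>a\<close>.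
\<close>

locale random_swaps =
  fixes V :: "'a set" and E :: "('a \<times> 'a) set" and a :: "'a \<times> 'a \<Rightarrow> real" and R :: real
  assumes finite_V: "finite V" and V_nonempty: "V \<noteq> {}"
    and E_subset: "E \<subseteq> V \<times> V"
    and a_nonneg: "\<And>e. e \<in> E \<Longrightarrow> a e \<ge> 0"
    and sum_a: "sum a E = 1"
    and R_pos: "R > 0"
    and resistance: "\<And>f x y. x \<in> V \<Longrightarrow> y \<in> V \<Longrightarrow>
      (f x - f y)\<^sup>2 \<le> R * (\<Sum>e\<in>E. a e * (f (fst e) - f (snd e))\<^sup>2)"
begin

section \<open>Transition operator of a single particle and its Dirichlet form\<close>

lemma swap_in_V [simp]: "e \<in> E \<Longrightarrow> swap e x \<in> V \<longleftrightarrow> x \<in> V"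
  using E_subset by (auto simp: swap_def Transposition.transpose_def)

lemma bij_swap: "e \<in> E \<Longrightarrow> bij_betw (swap e) V V"
  using E_subset unfolding swap_def by (intro bij_betw_transpose_iff) auto

definition step :: "('a \<Rightarrow> real) \<Rightarrow> 'a \<Rightarrow> real" where
  "step f x = (\<Sum>e\<in>E. a e * f (swap e x))"

lemma step_sum: "step (\<lambda>x. \<Sum>i\<in>I. f i x) x = (\<Sum>i\<in>I. step (f i) x)"
  unfolding step_def by (simp add: sum_distrib_left, rule sum.swap)

lemma step_cmult: "step (\<lambda>x. c * f x) x = c * step f x"
  unfolding step_def by (simp add: sum_distrib_left ac_simps)

text \<open>Each transposition is an involution of \<open>V\<close>, so substituting
  \<open>swap e x\<close> for \<open>x\<close> moves it from one factor to the other.\<close>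

lemma step_selfadjoint: "(\<Sum>x\<in>V. f x * step g x) = (\<Sum>x\<in>V. step f x * g x)"
proof -
  have *: "(\<Sum>x\<in>V. f x * g (swap e x)) = (\<Sum>x\<in>V. f (swap e x) * g x)" if "e \<in> E" for e
    using sum.reindex_bij_betw[OF bij_swap[OF that], of "\<lambda>x. f x * g (swap e x)"] by simp
  have "(\<Sum>x\<in>V. f x * step g x) = (\<Sum>e\<in>E. a e * (\<Sum>x\<in>V. f x * g (swap e x)))"
    unfolding step_def sum_distrib_left by (subst sum.swap) (simp add: ac_simps)
  also have "\<dots> = (\<Sum>e\<in>E. a e * (\<Sum>x\<in>V. f (swap e x) * g x))"
    using * by simp
  also have "\<dots> = (\<Sum>x\<in>V. step f x * g x)"
    unfolding step_def sum_distrib_left sum_distrib_right by (subst sum.swap) (simp add: ac_simps)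
  finally show ?thesis .
qed

text \<open>A transposition moves only its two endpoints, and their contributions add up to the full
  square of the difference.\<close>

lemma energy:
  "(\<Sum>x\<in>V. f x * (f x - step f x)) = (\<Sum>e\<in>E. a e * (f (fst e) - f (snd e))\<^sup>2)"
proof -
  have *: "(\<Sum>x\<in>V. f x * (f x - f (swap e x))) = (f (fst e) - f (snd e))\<^sup>2" if "e \<in> E" for e
  proof (cases "fst e = snd e")
    case False
    have "(\<Sum>x\<in>V. f x * (f x - f (swap e x))) = (\<Sum>x\<in>{fst e, snd e}. f x * (f x - f (swap e x)))"
      using that E_subset finite_V
      by (intro sum.mono_neutral_right) (auto simp: swap_def Transposition.transpose_def)
    then show ?thesis
      using False by (simp add: swap_def power2_eq_square algebra_simps)
  qed (simp add: swap_def)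
  have "f x - step f x = (\<Sum>e\<in>E. a e * (f x - f (swap e x)))" for x
    using sum_a by (simp add: step_def right_diff_distrib sum_subtractf flip: sum_distrib_right)
  then have "(\<Sum>x\<in>V. f x * (f x - step f x)) = (\<Sum>e\<in>E. a e * (\<Sum>x\<in>V. f x * (f x - f (swap e x))))"
    by (simp only: sum_distrib_left) (subst sum.swap, simp add: ac_simps)
  then show ?thesis
    by (simp add: *)
qed

text \<open>Here \<open>f\<close> is the voltage of a unit current entering by \<open>p\<close> and
  leaving by \<open>q\<close>. Its energy is its mean under \<open>p\<close> minus its mean under
  \<open>q\<close>, so at most its oscillation. The squared oscillation is at most \<open>R\<close>
  times the energy, and one factor cancels.\<close>

lemma oscillation_le:
  assumes eq: "\<And>x. x \<in> V \<Longrightarrow> f x - step f x = p x - q x"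
    and p: "\<And>x. x \<in> V \<Longrightarrow> p x \<ge> 0" "sum p V = 1"
    and q: "\<And>x. x \<in> V \<Longrightarrow> q x \<ge> 0" "sum q V = 1"
    and xy: "x \<in> V" "y \<in> V"
  shows "f x - f y \<le> R"
proof -
  have "Max (f ` V) \<in> f ` V" "Min (f ` V) \<in> f ` V"
    using finite_V V_nonempty by (auto intro: Max_in Min_in)
  then obtain u v where uv: "u \<in> V" "v \<in> V" "f u = Max (f ` V)" "f v = Min (f ` V)"
    by auto
  have bounds: "f v \<le> f z" "f z \<le> f u" if "z \<in> V" for z
    using that finite_V by (simp_all add: uv)
  have "(\<Sum>e\<in>E. a e * (f (fst e) - f (snd e))\<^sup>2) = (\<Sum>x\<in>V. f x * p x) - (\<Sum>x\<in>V. f x * q x)"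
    by (simp add: eq right_diff_distrib sum_subtractf flip: energy)
  also have "\<dots> \<le> (\<Sum>x\<in>V. f u * p x) - (\<Sum>x\<in>V. f v * q x)"
    using bounds p q by (intro diff_mono sum_mono mult_right_mono) auto
  also have "\<dots> = f u - f v"
    by (simp add: p q flip: sum_distrib_left)
  finally have "(\<Sum>e\<in>E. a e * (f (fst e) - f (snd e))\<^sup>2) \<le> f u - f v" .
  then have "(f u - f v)\<^sup>2 \<le> R * (f u - f v)"
    using resistance[of u v f] uv R_pos by (meson mult_left_mono less_imp_le order_trans)
  then have "f u - f v \<le> R"
    using R_pos bounds[OF uv(1)] by (cases "f u - f v > 0") (auto simp: power2_eq_square)
  then show ?thesis
    using bounds xy by (smt (verit))
qed

section \<open>Heat kernel and truncated Green function\<close>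

definition heat :: "nat \<Rightarrow> 'a \<Rightarrow> 'a \<Rightarrow> real" where
  "heat t y = (step ^^ t) (\<lambda>x. of_bool (x = y))"

lemma heat_0: "heat 0 y x = of_bool (x = y)"
  by (simp add: heat_def)

lemma heat_Suc: "heat (Suc t) y = step (heat t y)"
  by (simp add: heat_def)

lemma heat_nonneg: "heat t y x \<ge> 0"
  by (induction t arbitrary: x) (auto simp: heat_0 heat_Suc step_def a_nonneg intro!: sum_nonneg)

lemma sum_heat: "y \<in> V \<Longrightarrow> (\<Sum>x\<in>V. heat t y x) = 1"
proof (induction t)
  case 0
  then show ?case using finite_V by (simp add: heat_0 of_bool_def)
next
  case (Suc t)
  have "step (\<lambda>_. 1) x = 1" for x
    by (simp add: step_def sum_a)
  then show ?case
    using step_selfadjoint[of "\<lambda>_. 1" "heat t y"] Suc by (simp add: heat_Suc)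
qed

text \<open>Selfadjointness of the iterated operator, tested on two point masses.\<close>

lemma heat_sym:
  assumes "x \<in> V" "y \<in> V"
  shows "heat t y x = heat t x y"
proof -
  have iter: "(\<Sum>z\<in>V. f z * (step ^^ t) g z) = (\<Sum>z\<in>V. (step ^^ t) f z * g z)" for f g
    by (induction t arbitrary: f g) (simp_all add: step_selfadjoint funpow_swap1)
  show ?thesis
    using iter[of "\<lambda>z. of_bool (z = x)" "\<lambda>z. of_bool (z = y)"] assms finite_V
    by (simp add: heat_def of_bool_def if_distrib if_distribR cong: if_cong)
qed

text \<open>Expected number of visits to \<open>y\<close> before time \<open>n\<close> of the walk
  from \<open>x\<close>: \<open>heat t y x\<close> is the probability to be at \<open>y\<close>
  after \<open>t\<close> steps.\<close>

definition green :: "nat \<Rightarrow> 'a \<Rightarrow> 'a \<Rightarrow> real" where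
  "green n y x = (\<Sum>t<n. heat t y x)"

text \<open>Telescoping in time gives a Poisson equation with a point source at \<open>y\<close> and
  the heat kernel at time \<open>n\<close> as sink, which is the form treated by
  \<open>oscillation_le\<close>.\<close>

lemma green_step: "green n y x - step (green n y) x = of_bool (x = y) - heat n y x"
proof -
  have "step (green n y) x = (\<Sum>t<n. heat (Suc t) y x)"
    using step_sum[of "\<lambda>t. heat t y" "{..<n}" x] by (simp add: green_def[abs_def] heat_Suc)
  then show ?thesis
    using sum_lessThan_telescope'[of "\<lambda>t. heat t y x" n]
    by (simp add: green_def sum_subtractf heat_0)
qed

lemma green_oscillation: "x \<in> V \<Longrightarrow> z \<in> V \<Longrightarrow> y \<in> V \<Longrightarrow> green n y x - green n y z \<le> R"
  using finite_V
  by (rule_tac oscillation_le[where p = "\<lambda>x. of_bool (x = y)" and q = "heat n y"])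
     (auto simp: green_step heat_nonneg sum_heat of_bool_def)

text \<open>
  The differences of \<open>green n y\<close> are bounded by the resistance uniformly in \<open>n\<close>, while its mean
  grows linearly; so its Cesaro average equidistributes at an explicit rate, and no estimate of
  the mixing time is needed.
\<close>

lemma green_ge:
  assumes "x \<in> V" "y \<in> V"
  shows "green n y x \<ge> n / card V - R"
proof -
  have c: "card V > 0"
    using finite_V V_nonempty by (simp add: card_gt_0_iff)
  have "(\<Sum>z\<in>V. green n y z) = n"
    unfolding green_def by (subst sum.swap) (simp add: sum_heat assms)
  moreover have "(\<Sum>z\<in>V. green n y z) \<le> (\<Sum>z\<in>V. green n y x + R)"
    using green_oscillation[of _ x y n] assms by (intro sum_mono) (simp add: algebra_simps)
  ultimately have "n \<le> card V * (green n y x + R)"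
    by simp
  then show ?thesis
    using c by (simp add: field_simps)
qed

section \<open>Potentials for the meeting of two particles\<close>

definition G :: real where
  "G = 2 * card V * R"

lemma G_pos: "G > 0"
  using R_pos finite_V V_nonempty by (simp add: G_def card_gt_0_iff)

text \<open>Off the diagonal a step in \<open>x\<close> raises the Cesaro average
  \<open>F y x\<close> of the Green functions by \<open>green n y x / n\<close>, which
  \<open>green_ge\<close> keeps above \<open>1 / (2 * N)\<close>. Reversing the sign and scaling by
  \<open>N\<close> gives the drop 1/2; the bound \<open>G\<close> is \<open>N\<close> times the
  oscillation bound \<open>2 * R\<close>.\<close>

lemma meeting_potential_exists:
  obtains g where
    "\<And>x y. x \<in> V \<Longrightarrow> y \<in> V \<Longrightarrow> 0 \<le> g x y \<and> g x y \<le> G"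
    "\<And>x y. x \<in> V \<Longrightarrow> y \<in> V \<Longrightarrow> g x y = g y x"
    "\<And>x y. x \<in> V \<Longrightarrow> y \<in> V \<Longrightarrow> x \<noteq> y \<Longrightarrow> (\<Sum>e\<in>E. a e * g (swap e x) y) \<le> g x y - 1 / 2"
proof -
  define N where "N = real (card V)"
  have N: "N > 0"
    using finite_V V_nonempty by (simp add: N_def card_gt_0_iff)
  \<comment> \<open>The least averaging length for which \<open>R / n\<close> is at most half of
    \<open>1 / N\<close>.\<close>
  define n where "n = nat \<lceil>2 * N * R\<rceil>"
  have n: "real n \<ge> 2 * N * R" "n > 0"
    using N R_pos by (simp_all add: n_def)
  define F where "F y x = (1 / n) * (\<Sum>k<n. green k y x)" for y x
  have F_step: "step (F y) x = F y x - of_bool (x = y) + green n y x / n" for x y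
  proof -
    have "step (F y) x = (1 / n) * (\<Sum>k<n. step (green k y) x)"
      unfolding F_def step_cmult step_sum ..
    also have "(\<Sum>k<n. step (green k y) x) = (\<Sum>k<n. green k y x - of_bool (x = y) + heat k y x)"
      by (intro sum.cong) (use green_step in \<open>simp_all add: algebra_simps\<close>)
    also have "\<dots> = (\<Sum>k<n. green k y x) - n * of_bool (x = y) + green n y x"
      by (simp add: sum.distrib sum_subtractf green_def)
    also have "(1 / n) * \<dots> = F y x - of_bool (x = y) + green n y x / n"
      using n by (simp add: F_def add_divide_distrib diff_divide_distrib)
    finally show ?thesis .
  qed
  have F_sym: "F y x = F x y" if "x \<in> V" "y \<in> V" for x y
    using that by (simp add: F_def green_def heat_sym)
  have F_osc: "F y x - F y z \<le> R" if "x \<in> V" "y \<in> V" "z \<in> V" for x y z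
  proof -
    have "F y x - F y z = (1 / n) * (\<Sum>k<n. green k y x - green k y z)"
      by (simp add: F_def sum_subtractf right_diff_distrib)
    also have "\<dots> \<le> (1 / n) * (\<Sum>k<n. R)"
      using green_oscillation that by (intro mult_left_mono sum_mono) auto
    finally show ?thesis
      using n by simp
  qed
  have "Max ((\<lambda>(x, y). F y x) ` (V \<times> V)) \<in> (\<lambda>(x, y). F y x) ` (V \<times> V)"
    using finite_V V_nonempty by (intro Max_in) auto
  then obtain u v where uv: "u \<in> V" "v \<in> V" "F v u = Max ((\<lambda>(x, y). F y x) ` (V \<times> V))"
    by auto
  have F_le: "F y x \<le> F v u" if "x \<in> V" "y \<in> V" for x y
    unfolding uv(3) using that finite_V by (intro Max_ge) auto
  \<comment> \<open>Two changes of one coordinate lead from the maximal pair to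
    \<open>(x, y)\<close>, with the symmetry of \<open>F\<close> applied in between; each costs at
    most \<open>R\<close>.\<close>
  have F_ge: "F y x \<ge> F v u - 2 * R" if "x \<in> V" "y \<in> V" for x y
    using F_osc[of u v y] F_osc[of v y x] F_sym[of v y] that uv by simp
  define g where "g x y = N * (F v u - F y x)" for x y
  show thesis
  proof (rule that[of g])
    fix x y assume xy: "x \<in> V" "y \<in> V"
    have "N * (F v u - F y x) \<le> N * (2 * R)"
      using F_ge[OF xy] N by (intro mult_left_mono) auto
    then show "0 \<le> g x y \<and> g x y \<le> G"
      using F_le[OF xy] N by (auto simp: g_def G_def N_def)
    show "g x y = g y x"
      using F_sym[OF xy] by (simp add: g_def)
    assume "x \<noteq> y"
    have "green n y x / n \<ge> (n / N - R) / n"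
      using green_ge[OF xy, of n] by (intro divide_right_mono) (auto simp: N_def)
    also have "(n / N - R) / n = 1 / N - R / n"
      using n N by (simp add: field_simps)
    finally have *: "green n y x / n \<ge> 1 / N - R / n" .
    have "R / n \<le> 1 / (2 * N)"
      using n N R_pos by (simp add: field_simps)
    moreover have "1 / N = 1 / (2 * N) + 1 / (2 * N)"
      using N by (simp add: field_simps)
    ultimately have *: "green n y x / n \<ge> 1 / (2 * N)"
      using * by linarith
    have "(\<Sum>e\<in>E. a e * g (swap e x) y) = N * F v u * sum a E - N * step (F y) x"
      by (simp add: g_def step_def sum_subtractf sum_distrib_left algebra_simps)
    also have "\<dots> = g x y - N * (green n y x / n)"
      using \<open>x \<noteq> y\<close> by (simp add: F_step sum_a g_def algebra_simps)
    also have "\<dots> \<le> g x y - N * (1 / (2 * N))"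
      using * N by (intro diff_left_mono mult_left_mono) auto
    finally show "(\<Sum>e\<in>E. a e * g (swap e x) y) \<le> g x y - 1 / 2"
      using N by simp
  qed
qed

text \<open>
  Adding the constant \<open>G\<close> to the potential absorbs the wrong boundary values that it takes on the
  diagonal, because the killed walk loses the mass \<open>G\<close> whenever the two particles meet.
\<close>

lemma killed_potential_exists:
  obtains u where
    "\<And>x y. x \<in> V \<Longrightarrow> y \<in> V \<Longrightarrow> G \<le> u x y \<and> u x y \<le> 2 * G"
    "\<And>x y. x \<in> V \<Longrightarrow> y \<in> V \<Longrightarrow> x \<noteq> y \<Longrightarrow>
      (\<Sum>e\<in>E. a e * (if {fst e, snd e} = {x, y} then 0 else u (swap e x) (swap e y)))
        \<le> (1 - 1 / (2 * G)) * u x y"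
proof -
  obtain g where g: "\<And>x y. x \<in> V \<Longrightarrow> y \<in> V \<Longrightarrow> 0 \<le> g x y \<and> g x y \<le> G"
    "\<And>x y. x \<in> V \<Longrightarrow> y \<in> V \<Longrightarrow> g x y = g y x"
    "\<And>x y. x \<in> V \<Longrightarrow> y \<in> V \<Longrightarrow> x \<noteq> y \<Longrightarrow> (\<Sum>e\<in>E. a e * g (swap e x) y) \<le> g x y - 1 / 2"
    using meeting_potential_exists by blast
  note G = G_pos
  define u where "u x y = g x y + G" for x y
  show thesis
  proof (rule that[of u])
    fix x y assume xy: "x \<in> V" "y \<in> V"
    show "G \<le> u x y \<and> u x y \<le> 2 * G"
      using g(1)[OF xy] by (simp add: u_def)
    assume ne: "x \<noteq> y"
    \<comment> \<open>Unless \<open>e\<close> joins \<open>x\<close> and \<open>y\<close>, it moves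
      at most one of the two particles, and the increments of \<open>g\<close> add up exactly. If it
      joins them, the left side is zero and \<open>g x y \<le> G\<close> makes the right side
      nonnegative.\<close>
    have *: "(if {fst e, snd e} = {x, y} then 0 else u (swap e x) (swap e y))
        \<le> g (swap e x) y + g (swap e y) x - g x y + G" (is "?l \<le> ?r") if e: "e \<in> E" for e
    proof (cases "{fst e, snd e} = {x, y}")
      case True
      then have "swap e x = y" "swap e y = x"
        by (auto simp: doubleton_eq_iff swap_def)
      then show ?thesis
        using True g(1)[OF xy] g(1)[of x x] g(1)[of y y] xy by simp
    next
      case False
      have fe: "swap e x \<in> V" "swap e y \<in> V"
        using xy e by auto
      have "g (swap e x) (swap e y) \<le> g (swap e x) y + g (swap e y) x - g x y"
      proof (cases "swap e x = x")
        case True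
        then show ?thesis
          using g(2)[OF xy(1) fe(2)] by simp
      next
        case fx: False
        then have "swap e y = y"
          using False ne by (auto simp: swap_def Transposition.transpose_def split: if_splits)
        then show ?thesis
          using g(2)[OF xy] by simp
      qed
      then show ?thesis
        using False by (simp add: u_def)
    qed
    have "(\<Sum>e\<in>E. a e * (if {fst e, snd e} = {x, y} then 0 else u (swap e x) (swap e y)))
        \<le> (\<Sum>e\<in>E. a e * (g (swap e x) y + g (swap e y) x - g x y + G))"
      using * a_nonneg by (intro sum_mono mult_left_mono) auto
    also have "\<dots> = (\<Sum>e\<in>E. a e * g (swap e x) y) + (\<Sum>e\<in>E. a e * g (swap e y) x)
        + (G - g x y) * sum a E"
      by (simp add: sum.distrib sum_subtractf sum_distrib_left sum_distrib_right algebra_simps)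
    also have "\<dots> \<le> u x y - 1"
      using g(3)[OF xy ne] g(3)[of y x] g(2)[OF xy] xy ne by (simp add: sum_a u_def)
    \<comment> \<open>Since \<open>u x y \<le> 2 * G\<close>, losing 1 is at least losing the
      fraction \<open>1 / (2 * G)\<close>.\<close>
    also have "\<dots> \<le> (1 - 1 / (2 * G)) * u x y"
      using g(1)[OF xy] G by (simp add: u_def field_simps)
    finally show "(\<Sum>e\<in>E. a e * (if {fst e, snd e} = {x, y} then 0 else u (swap e x) (swap e y)))
        \<le> (1 - 1 / (2 * G)) * u x y" .
  qed
qed

end

section \<open>Conservation laws of the exchange rule\<close>

definition valid_state :: "nat set \<Rightarrow> (nat \<Rightarrow> int) \<Rightarrow> bool" where
  "valid_state V S \<longleftrightarrow> (\<forall>x\<in>V. S x \<in> {2, -2, 1, -1})"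

definition strong_sign :: "int \<Rightarrow> int" where
  "strong_sign s = (if s = 2 then 1 else if s = -2 then -1 else 0)"

definition vote_margin :: "nat set \<Rightarrow> (nat \<Rightarrow> int) \<Rightarrow> int" where
  "vote_margin V S = (\<Sum>x\<in>V. strong_sign (S x))"

definition strong_pairs :: "nat set \<Rightarrow> (nat \<Rightarrow> int) \<Rightarrow> (nat \<times> nat) set" where
  "strong_pairs V S = {(x, y) \<in> V \<times> V. S x = -2 \<and> S y = 2}"

text \<open>For a valid configuration of positive margin these pairs exist exactly as long as
  consensus fails, because a strong positive node is always there.\<close>

definition mixed_pairs :: "nat set \<Rightarrow> (nat \<Rightarrow> int) \<Rightarrow> (nat \<times> nat) set" where
  "mixed_pairs V S = {(x, y) \<in> V \<times> V. S x < 0 \<and> S y = 2}"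

lemma activate_eq:
  "activate (i, j) S = S(i := fst (exchange (S i) (S j)), j := snd (exchange (S i) (S j)))"
  by (simp add: activate_def split: prod.split)

lemma activate_uminus: "activate e (- S) = - activate e S"
proof -
  have "exchange (- a) (- b) = map_prod uminus uminus (exchange a b)" for a b
    by (auto simp: exchange_def sgn_if)
  then show ?thesis
    by (cases e) (auto simp: activate_eq fun_eq_iff map_prod_def split: prod.split)
qed

lemma valid_state_activate:
  assumes "valid_state V S" "i \<in> V" "j \<in> V"
  shows "valid_state V (activate (i, j) S)"
proof -
  have "S i \<in> {2, -2, 1, -1}" "S j \<in> {2, -2, 1, -1}"
    using assms by (auto simp: valid_state_def)
  then have "fst (exchange (S i) (S j)) \<in> {2, -2, 1, -1}"
    "snd (exchange (S i) (S j)) \<in> {2, -2, 1, -1}"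
    by (auto simp: exchange_def)
  then show ?thesis
    using assms(1) by (auto simp: valid_state_def activate_eq)
qed

text \<open>Strong opinions are either moved to the other node or weakened in pairs of opposite
  sign.\<close>

lemma vote_margin_activate:
  assumes "valid_state V S" "i \<in> V" "j \<in> V" "i \<noteq> j" "finite V"
  shows "vote_margin V (activate (i, j) S) = vote_margin V S"
proof -
  have split: "vote_margin V T = strong_sign (T i) + strong_sign (T j)
      + (\<Sum>x\<in>V - {i} - {j}. strong_sign (T x))" for T
    using assms by (simp add: vote_margin_def sum.remove[of V i] sum.remove[of "V - {i}" j])
  have "S i = 2 \<or> S i = -2 \<or> S i = 1 \<or> S i = -1" "S j = 2 \<or> S j = -2 \<or> S j = 1 \<or> S j = -1"
    using assms by (auto simp: valid_state_def)
  then have "strong_sign (fst (exchange (S i) (S j))) + strong_sign (snd (exchange (S i) (S j)))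
      = strong_sign (S i) + strong_sign (S j)"
    by (elim disjE) (simp_all add: exchange_def strong_sign_def)
  moreover have "(\<Sum>x\<in>V - {i} - {j}. strong_sign (activate (i, j) S x))
      = (\<Sum>x\<in>V - {i} - {j}. strong_sign (S x))"
    by (intro sum.cong) (auto simp: activate_eq)
  ultimately show ?thesis
    using \<open>i \<noteq> j\<close> by (simp add: split activate_eq)
qed

lemma strong_positive_exists:
  assumes "vote_margin V S > 0"
  shows "\<exists>y\<in>V. S y = 2"
proof (rule ccontr)
  assume "\<not> ?thesis"
  then have "vote_margin V S \<le> 0"
    unfolding vote_margin_def by (intro sum_nonpos) (auto simp: strong_sign_def)
  then show False
    using assms by simp
qed

lemma swap_cases:
  assumes "i \<noteq> j"
  obtains "x = i" "swap (i, j) x = j" | "x = j" "swap (i, j) x = i"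
    | "x \<noteq> i" "x \<noteq> j" "swap (i, j) x = x"
  using assms by (cases "x = i"; cases "x = j") (auto simp: swap_def)

context
  fixes V :: "nat set" and S :: "nat \<Rightarrow> int" and i j :: nat
  assumes S: "valid_state V S" and ij: "i \<in> V" "j \<in> V" "i \<noteq> j"
begin

lemma states: "S i = 2 \<or> S i = -2 \<or> S i = 1 \<or> S i = -1" "S j = 2 \<or> S j = -2 \<or> S j = 1 \<or> S j = -1"
  using S ij by (auto simp: valid_state_def)

text \<open>No exchange creates a strong opinion; one found at \<open>x\<close> has been carried
  there by the transposition.\<close>

lemma activate_strong:
  assumes "activate (i, j) S x = c" "c = 2 \<or> c = -2"
  shows "S (swap (i, j) x) = c"
  using swap_cases[OF ij(3), of x]
proof cases
  case 1
  then show ?thesis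
    using assms ij(3) states by (elim disjE) (simp_all add: activate_eq exchange_def)
next
  case 2
  then show ?thesis
    using assms ij(3) states by (elim disjE) (simp_all add: activate_eq exchange_def)
next
  case 3
  then show ?thesis
    using assms(1) by (simp add: activate_eq)
qed

text \<open>Only a strong negative opinion can turn a positive one negative; without it at either
  node, negative opinions are merely carried or converted.\<close>

lemma activate_negative:
  assumes "activate (i, j) S x < 0" "S i \<noteq> -2" "S j \<noteq> -2"
  shows "S (swap (i, j) x) < 0"
  using swap_cases[OF ij(3), of x]
proof cases
  case 1
  then show ?thesis
    using assms ij(3) states by (elim disjE) (simp_all add: activate_eq exchange_def)
next
  case 2
  then show ?thesis
    using assms ij(3) states by (elim disjE) (simp_all add: activate_eq exchange_def)
next
  case 3
  then show ?thesis
    using assms(1) by (simp add: activate_eq)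
qed

text \<open>A strong positive opinion converts a weak negative partner and is itself weakened by a
  strong negative one. Hence a pair that has just met is lost, as in the killed potential.\<close>

lemma activate_separates:
  assumes "activate (i, j) S x < 0" "activate (i, j) S y = 2"
  shows "{i, j} \<noteq> {x, y}"
proof
  assume "{i, j} = {x, y}"
  then consider "x = i" "y = j" | "x = j" "y = i"
    by (auto simp: doubleton_eq_iff)
  then show False
  proof cases
    case 1
    then show False
      using assms ij(3) states by (elim disjE) (simp_all add: activate_eq exchange_def)
  next
    case 2
    then show False
      using assms ij(3) states by (elim disjE) (simp_all add: activate_eq exchange_def)
  qed
qed

end

section \<open>Contraction of the configuration potential\<close>

context random_swaps
begin

text \<open>The value of \<open>u\<close> after one activation for a pair of particles killed on
  meeting, as averaged in \<open>killed_potential_exists\<close>.\<close>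

definition met :: "('a \<times> 'a \<Rightarrow> real) \<Rightarrow> 'a \<times> 'a \<Rightarrow> 'a \<times> 'a \<Rightarrow> real" where
  "met u e p = (if {fst e, snd e} = {fst p, snd p} then 0 else u (map_prod (swap e) (swap e) p))"

lemma met_nonneg:
  assumes "e \<in> E" "p \<in> V \<times> V" "\<And>p. p \<in> V \<times> V \<Longrightarrow> u p \<ge> 0"
  shows "met u e p \<ge> 0"
  using assms(1,2) by (cases p) (auto simp: met_def intro!: assms(3))

text \<open>The transposition maps the new pairs injectively to old pairs that have not met, so each
  new term is the killed term of an old pair; the remaining killed terms are nonnegative.\<close>

lemma sum_pairs_le_killed:
  assumes e: "e \<in> E" and K: "K \<subseteq> V \<times> V"
    and u: "\<And>p. p \<in> V \<times> V \<Longrightarrow> u p \<ge> 0"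
    and step: "\<And>x y. (x, y) \<in> K' \<Longrightarrow> (swap e x, swap e y) \<in> K \<and> {fst e, snd e} \<noteq> {x, y}"
  shows "sum u K' \<le> sum (met u e) K"
proof -
  let ?s = "map_prod (swap e) (swap e)"
  have inj: "inj_on ?s K'"
    using inj_swap[of e] by (meson inj_on_subset prod.inj_map subset_UNIV)
  \<comment> \<open>The transposition preserves the set of its endpoints, so the killing condition
    is the same before and after it.\<close>
  have m: "met u e (?s p) = u p" if "p \<in> K'" for p
  proof (cases p)
    case (Pair x y)
    have "{fst e, snd e} = {swap e x, swap e y} \<longleftrightarrow> {fst e, snd e} = {x, y}"
      using inj_image_eq_iff[OF inj_swap, of e "{fst e, snd e}" "{x, y}"]
      by (simp add: swap_def insert_commute)
    then show ?thesis
      using step[of x y] that Pair by (simp add: met_def)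
  qed
  have "sum u K' = sum (met u e) (?s ` K')"
    using inj m by (simp add: sum.reindex)
  also have "\<dots> \<le> sum (met u e) K"
  proof (rule sum_mono2)
    show "finite K"
      using K finite_V by (meson finite_SigmaI finite_subset)
    show "?s ` K' \<subseteq> K"
      using step by auto
    show "met u e p \<ge> 0" if "p \<in> K - ?s ` K'" for p
      using that K e u by (intro met_nonneg) auto
  qed
  finally show ?thesis .
qed

lemma sum_killed_le:
  assumes "K \<subseteq> V \<times> V" "\<And>p. p \<in> K \<Longrightarrow> (\<Sum>e\<in>E. a e * met u e p) \<le> r * u p"
  shows "(\<Sum>e\<in>E. a e * sum (met u e) K) \<le> r * sum u K"
proof -
  have "(\<Sum>e\<in>E. a e * sum (met u e) K) = (\<Sum>p\<in>K. \<Sum>e\<in>E. a e * met u e p)"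
    by (simp add: sum_distrib_left, rule sum.swap)
  also have "\<dots> \<le> (\<Sum>p\<in>K. r * u p)"
    using assms by (intro sum_mono) auto
  finally show ?thesis
    by (simp add: sum_distrib_left)
qed

end

locale voting_swaps = random_swaps V E a R for V :: "nat set" and E a R +
  assumes loop_free: "(i, j) \<in> E \<Longrightarrow> i \<noteq> j"
begin

text \<open>
  Strong opinions and negative opinions ride on the transported particles. A strong particle of
  each sign is lost when such particles meet, whence the potential summed over \<open>strong_pairs\<close>
  contracts. The one summed over \<open>mixed_pairs\<close> contracts as soon as no strong negative opinion is
  left; before that, the growth it undergoes is paid for by the multiple of the former.
\<close>

lemma consensus_potential_exists:
  obtains \<Psi> where
    "\<And>S. 0 \<le> \<Psi> S"
    "\<And>S. \<Psi> S \<le> 2 * real (card V) ^ 2 * (1 + 8 * real (card V) ^ 2 * G)"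
    "\<And>S. valid_state V S \<Longrightarrow> vote_margin V S > 0 \<Longrightarrow> \<not> consensus V S \<Longrightarrow> 1 \<le> \<Psi> S"
    "\<And>S. valid_state V S \<Longrightarrow> vote_margin V S > 0 \<Longrightarrow>
      (\<Sum>e\<in>E. a e * \<Psi> (activate e S)) \<le> (1 - 1 / (4 * G)) * \<Psi> S"
proof -
  obtain u' where u': "\<And>x y. x \<in> V \<Longrightarrow> y \<in> V \<Longrightarrow> G \<le> u' x y \<and> u' x y \<le> 2 * G"
    "\<And>x y. x \<in> V \<Longrightarrow> y \<in> V \<Longrightarrow> x \<noteq> y \<Longrightarrow>
      (\<Sum>e\<in>E. a e * (if {fst e, snd e} = {x, y} then 0 else u' (swap e x) (swap e y)))
        \<le> (1 - 1 / (2 * G)) * u' x y"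
    using killed_potential_exists by blast
  define u where "u p = u' (fst p) (snd p)" for p
  note G = G_pos
  have u: "G \<le> u p" "u p \<le> 2 * G" "0 \<le> u p" if "p \<in> V \<times> V" for p
    using that u'(1)[of "fst p" "snd p"] G by (auto simp: u_def mem_Times_iff)
  have killed: "(\<Sum>e\<in>E. a e * met u e p) \<le> (1 - 1 / (2 * G)) * u p"
    if "p \<in> V \<times> V" "fst p \<noteq> snd p" for p
    unfolding met_def u_def fst_map_prod snd_map_prod
    using that by (intro u'(2)) (auto simp: mem_Times_iff)
  define N where "N = real (card V)"
  \<comment> \<open>Chosen so that the growth \<open>2 * N\<^sup>2 * \<Phi>\<^sub>1 S\<close> equals
    \<open>A * \<Phi>\<^sub>1 S / (4 * G)\<close>, half of the decay of
    \<open>A * \<Phi>\<^sub>1 S\<close>.\<close>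
  define A where "A = 8 * N\<^sup>2 * G"
  have A: "A \<ge> 0"
    using G by (simp add: A_def)
  define \<Phi>\<^sub>1 where "\<Phi>\<^sub>1 S = sum u (strong_pairs V S)" for S
  define \<Phi>\<^sub>2 where "\<Phi>\<^sub>2 S = sum u (mixed_pairs V S)" for S
  have sub: "strong_pairs V S \<subseteq> V \<times> V" "mixed_pairs V S \<subseteq> V \<times> V" for S
    by (auto simp: strong_pairs_def mixed_pairs_def)
  have fin: "finite K" if "K \<subseteq> V \<times> V" for K
    using that finite_V by (meson finite_SigmaI finite_subset)
  have nonneg: "sum u K \<ge> 0" if "K \<subseteq> V \<times> V" for K
    using that u by (intro sum_nonneg) auto
  have upper: "sum u K \<le> 2 * N\<^sup>2 * G" if "K \<subseteq> V \<times> V" for K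
  proof -
    have "sum u K \<le> sum u (V \<times> V)"
      using that fin u by (intro sum_mono2) auto
    also have "\<dots> \<le> card (V \<times> V) * (2 * G)"
      using u by (intro sum_bounded_above) auto
    finally show ?thesis
      by (simp add: N_def power2_eq_square card_cartesian_product ac_simps)
  qed
  have lower: "sum u K \<ge> G" if "K \<subseteq> V \<times> V" "K \<noteq> {}" for K
  proof -
    from that obtain p where p: "p \<in> K"
      by blast
    then have "u p \<le> sum u K"
      using that fin u by (intro member_le_sum) auto
    then show ?thesis
      using u(1)[of p] p that by auto
  qed
  \<comment> \<open>A single pair contributes at least \<open>G\<close>; dividing by it normalizes
    the lower bound to 1.\<close>
  define \<Psi> where "\<Psi> S = (\<Phi>\<^sub>2 S + A * \<Phi>\<^sub>1 S) / G" for S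
  show thesis
  proof (rule that[of \<Psi>])
    fix S
    show "0 \<le> \<Psi> S"
      using G A nonneg sub by (simp add: \<Psi>_def \<Phi>\<^sub>1_def \<Phi>\<^sub>2_def)
    have "\<Phi>\<^sub>2 S + A * \<Phi>\<^sub>1 S \<le> 2 * N\<^sup>2 * G + A * (2 * N\<^sup>2 * G)"
      using A upper sub by (intro add_mono mult_left_mono) (auto simp: \<Phi>\<^sub>1_def \<Phi>\<^sub>2_def)
    then have "\<Psi> S \<le> (2 * N\<^sup>2 * G + A * (2 * N\<^sup>2 * G)) / G"
      using G unfolding \<Psi>_def by (intro divide_right_mono) auto
    also have "\<dots> = 2 * N\<^sup>2 * (1 + A)"
      using G by (simp add: field_simps)
    finally show "\<Psi> S \<le> 2 * real (card V) ^ 2 * (1 + 8 * real (card V) ^ 2 * G)"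
      by (simp only: A_def N_def)
    assume S: "valid_state V S" and margin: "vote_margin V S > 0"
    obtain y where y: "y \<in> V" "S y = 2"
      using strong_positive_exists[OF margin] by blast
    show "1 \<le> \<Psi> S" if nc: "\<not> consensus V S"
    proof -
      obtain x where "x \<in> V" "S x < 0"
        using nc S by (force simp: consensus_def valid_state_def)
      then have "mixed_pairs V S \<noteq> {}"
        using y by (auto simp: mixed_pairs_def)
      then have "G \<le> \<Phi>\<^sub>2 S"
        using lower sub by (simp add: \<Phi>\<^sub>2_def)
      moreover have "0 \<le> A * \<Phi>\<^sub>1 S"
        using A nonneg sub by (simp add: \<Phi>\<^sub>1_def)
      ultimately show ?thesis
        using G by (simp add: \<Psi>_def)
    qed
    have \<Phi>\<^sub>1_activate: "\<Phi>\<^sub>1 (activate e S) \<le> sum (met u e) (strong_pairs V S)"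
      and \<Phi>\<^sub>2_activate: "\<Phi>\<^sub>2 (activate e S) \<le> sum (met u e) (mixed_pairs V S) + 2 * N\<^sup>2 * \<Phi>\<^sub>1 S"
      if e: "e \<in> E" for e
    proof -
      obtain i j where ij: "e = (i, j)" "i \<in> V" "j \<in> V" "i \<noteq> j"
        using e E_subset loop_free by (cases e) auto
      note strong = activate_strong[OF S ij(2-4)]
        and neg = activate_negative[OF S ij(2-4)]
        and sep = activate_separates[OF S ij(2-4)]
      show "\<Phi>\<^sub>1 (activate e S) \<le> sum (met u e) (strong_pairs V S)"
        unfolding \<Phi>\<^sub>1_def
      proof (rule sum_pairs_le_killed[OF e sub(1) u(3)])
        fix x y assume "(x, y) \<in> strong_pairs V (activate e S)"
        then show "(swap e x, swap e y) \<in> strong_pairs V S \<and> {fst e, snd e} \<noteq> {x, y}"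
          using strong[of x "-2"] strong[of y 2] sep[of x y] e by (auto simp: strong_pairs_def ij(1))
      qed
      show "\<Phi>\<^sub>2 (activate e S) \<le> sum (met u e) (mixed_pairs V S) + 2 * N\<^sup>2 * \<Phi>\<^sub>1 S"
      proof (cases "strong_pairs V S = {}")
        case True
        \<comment> \<open>The strong positive node \<open>y\<close> would form a strong pair with
          any strong negative node.\<close>
        then have no_strong: "S x \<noteq> -2" if "x \<in> V" for x
          using y that by (auto simp: strong_pairs_def)
        have "\<Phi>\<^sub>2 (activate e S) \<le> sum (met u e) (mixed_pairs V S)"
          unfolding \<Phi>\<^sub>2_def
        proof (rule sum_pairs_le_killed[OF e sub(2) u(3)])
          fix x y assume "(x, y) \<in> mixed_pairs V (activate e S)"
          then show "(swap e x, swap e y) \<in> mixed_pairs V S \<and> {fst e, snd e} \<noteq> {x, y}"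
            using neg[of x] no_strong strong[of y 2] sep[of x y] e ij
            by (auto simp: mixed_pairs_def)
        qed
        then show ?thesis
          by (simp add: \<Phi>\<^sub>1_def True)
      next
        case False
        \<comment> \<open>While a strong pair exists, \<open>\<Phi>\<^sub>1 S \<ge> G\<close>, so
          even the trivial bound over all pairs is a multiple of
          \<open>\<Phi>\<^sub>1 S\<close>.\<close>
        have "\<Phi>\<^sub>2 (activate e S) \<le> 2 * N\<^sup>2 * G"
          using upper sub by (simp add: \<Phi>\<^sub>2_def)
        also have "\<dots> \<le> 2 * N\<^sup>2 * \<Phi>\<^sub>1 S"
          using lower[OF sub(1) False] by (intro mult_left_mono) (auto simp: \<Phi>\<^sub>1_def)
        finally have "\<Phi>\<^sub>2 (activate e S) \<le> 2 * N\<^sup>2 * \<Phi>\<^sub>1 S" .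
        moreover have "0 \<le> sum (met u e) (mixed_pairs V S)"
          using sub e u by (intro sum_nonneg met_nonneg) auto
        ultimately show ?thesis
          by simp
      qed
    qed
    have "(\<Sum>e\<in>E. a e * \<Phi>\<^sub>1 (activate e S)) \<le> (\<Sum>e\<in>E. a e * sum (met u e) (strong_pairs V S))"
      using \<Phi>\<^sub>1_activate a_nonneg by (intro sum_mono mult_left_mono)
    also have "\<dots> \<le> (1 - 1 / (2 * G)) * \<Phi>\<^sub>1 S"
      unfolding \<Phi>\<^sub>1_def using sub by (intro sum_killed_le killed) (auto simp: strong_pairs_def)
    finally have drift\<^sub>1: "(\<Sum>e\<in>E. a e * \<Phi>\<^sub>1 (activate e S)) \<le> (1 - 1 / (2 * G)) * \<Phi>\<^sub>1 S" .
    have "(\<Sum>e\<in>E. a e * \<Phi>\<^sub>2 (activate e S))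
        \<le> (\<Sum>e\<in>E. a e * (sum (met u e) (mixed_pairs V S) + 2 * N\<^sup>2 * \<Phi>\<^sub>1 S))"
      using \<Phi>\<^sub>2_activate a_nonneg by (intro sum_mono mult_left_mono)
    also have "\<dots> = (\<Sum>e\<in>E. a e * sum (met u e) (mixed_pairs V S)) + sum a E * (2 * N\<^sup>2 * \<Phi>\<^sub>1 S)"
      by (simp only: distrib_left sum.distrib sum_distrib_right)
    also have "(\<Sum>e\<in>E. a e * sum (met u e) (mixed_pairs V S)) \<le> (1 - 1 / (2 * G)) * \<Phi>\<^sub>2 S"
      unfolding \<Phi>\<^sub>2_def using sub by (intro sum_killed_le killed) (auto simp: mixed_pairs_def)
    finally have drift\<^sub>2: "(\<Sum>e\<in>E. a e * \<Phi>\<^sub>2 (activate e S))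
        \<le> (1 - 1 / (2 * G)) * \<Phi>\<^sub>2 S + 2 * N\<^sup>2 * \<Phi>\<^sub>1 S"
      by (simp add: sum_a)
    have "(\<Sum>e\<in>E. a e * \<Psi> (activate e S))
        = ((\<Sum>e\<in>E. a e * \<Phi>\<^sub>2 (activate e S)) + A * (\<Sum>e\<in>E. a e * \<Phi>\<^sub>1 (activate e S))) / G"
      by (simp add: \<Psi>_def sum_distrib_left sum_divide_distrib sum.distrib algebra_simps
          add_divide_distrib)
    also have "\<dots> \<le> ((1 - 1 / (2 * G)) * \<Phi>\<^sub>2 S + 2 * N\<^sup>2 * \<Phi>\<^sub>1 S
        + A * ((1 - 1 / (2 * G)) * \<Phi>\<^sub>1 S)) / G"
      using drift\<^sub>1 drift\<^sub>2 A G by (intro divide_right_mono add_mono mult_left_mono) auto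
    also have "2 * N\<^sup>2 * \<Phi>\<^sub>1 S = A * \<Phi>\<^sub>1 S / (4 * G)"
      using G by (simp add: A_def)
    also have "((1 - 1 / (2 * G)) * \<Phi>\<^sub>2 S + A * \<Phi>\<^sub>1 S / (4 * G) + A * ((1 - 1 / (2 * G)) * \<Phi>\<^sub>1 S)) / G
        = (1 - 1 / (4 * G)) * \<Psi> S - \<Phi>\<^sub>2 S / (4 * G * G)"
      using G by (simp add: \<Psi>_def field_simps)
    also have "\<dots> \<le> (1 - 1 / (4 * G)) * \<Psi> S"
      using G nonneg sub by (simp add: \<Phi>\<^sub>2_def)
    finally show "(\<Sum>e\<in>E. a e * \<Psi> (activate e S)) \<le> (1 - 1 / (4 * G)) * \<Psi> S" .
  qed
qed

end

section \<open>Expected hitting times of the activation process\<close>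

lemma measurable_node_states:
  assumes f: "f \<in> M \<rightarrow>\<^sub>M count_space UNIV" and g: "g \<in> M \<rightarrow>\<^sub>M stream_space (count_space UNIV)"
  shows "(\<lambda>x. node_states (f x) (g x) t) \<in> M \<rightarrow>\<^sub>M count_space UNIV"
proof (induction t)
  case 0
  then show ?case using f by simp
next
  case (Suc t)
  have "(\<lambda>x. g x !! t) \<in> M \<rightarrow>\<^sub>M count_space UNIV"
    using g by measurable
  \<comment> \<open>Configurations are uncountable but activated pairs are countable, so it suffices
    to treat each fixed pair \<open>e\<close>.\<close>
  moreover have "(\<lambda>x. activate e (node_states (f x) (g x) t)) \<in> M \<rightarrow>\<^sub>M count_space UNIV" for e
    by (rule measurable_compose[OF Suc]) simp
  ultimately show ?case
    by (auto intro: measurable_compose_countable)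
qed

lemma sets_stream_space_pmf:
  "sets (stream_space (measure_pmf p)) = sets (stream_space (count_space UNIV))"
  by (intro sets_stream_space_cong) simp

lemma measurable_node_states_stream [measurable]:
  "(\<lambda>\<omega>. node_states S \<omega> t) \<in> stream_space (measure_pmf p) \<rightarrow>\<^sub>M count_space UNIV"
  using sets_stream_space_pmf[of p]
  by (intro measurable_node_states) (simp_all cong: measurable_cong_sets)

lemma measurable_node_states_pair [measurable]:
  "(\<lambda>(S, \<omega>). node_states S \<omega> t)
    \<in> measure_pmf \<mu> \<Otimes>\<^sub>M stream_space (measure_pmf p) \<rightarrow>\<^sub>M count_space UNIV"
proof -
  have "fst \<in> measure_pmf \<mu> \<Otimes>\<^sub>M stream_space (measure_pmf p) \<rightarrow>\<^sub>M count_space UNIV"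
    using measurable_fst[of "measure_pmf \<mu>" "stream_space (measure_pmf p)"]
    by (simp cong: measurable_cong_sets)
  moreover have "snd \<in> measure_pmf \<mu> \<Otimes>\<^sub>M stream_space (measure_pmf p) \<rightarrow>\<^sub>M stream_space (count_space UNIV)"
    using measurable_snd[of "measure_pmf \<mu>" "stream_space (measure_pmf p)"] sets_stream_space_pmf[of p]
    by (simp cong: measurable_cong_sets)
  ultimately show ?thesis
    unfolding case_prod_beta by (rule measurable_node_states)
qed

section \<open>First-step analysis and summation of tails\<close>

lemma node_states_Cons: "node_states S (e ## \<omega>) (Suc t) = node_states (activate e S) \<omega> t"
  by (induction t) simp_all

text \<open>Independence splits off the first activation, after which the process restarts from
  \<open>activate e S\<close>; the drift contributes one factor \<open>r\<close>, and the invariant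
  \<open>I\<close> keeps it applicable.\<close>

lemma nn_integral_node_states_le:
  fixes \<Psi> :: "(nat \<Rightarrow> int) \<Rightarrow> ennreal"
  assumes inv: "\<And>S e. I S \<Longrightarrow> e \<in> set_pmf p \<Longrightarrow> I (activate e S)"
    and drift: "\<And>S. I S \<Longrightarrow> (\<integral>\<^sup>+e. \<Psi> (activate e S) \<partial>measure_pmf p) \<le> r * \<Psi> S"
    and "I S"
  shows "(\<integral>\<^sup>+\<omega>. \<Psi> (node_states S \<omega> t) \<partial>stream_space (measure_pmf p)) \<le> r ^ t * \<Psi> S"
  using \<open>I S\<close>
proof (induction t arbitrary: S)
  case 0
  interpret prob_space "stream_space (measure_pmf p)"
    by (intro prob_space.prob_space_stream_space prob_space_measure_pmf)
  show ?case
    by (simp add: emeasure_space_1)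
next
  case (Suc t)
  have "(\<integral>\<^sup>+\<omega>. \<Psi> (node_states S \<omega> (Suc t)) \<partial>stream_space (measure_pmf p))
      = (\<integral>\<^sup>+e. \<integral>\<^sup>+\<omega>. \<Psi> (node_states S (e ## \<omega>) (Suc t)) \<partial>stream_space (measure_pmf p) \<partial>measure_pmf p)"
    by (intro prob_space.nn_integral_stream_space prob_space_measure_pmf
        measurable_compose[OF measurable_node_states_stream]) simp
  also have "\<dots> \<le> (\<integral>\<^sup>+e. r ^ t * \<Psi> (activate e S) \<partial>measure_pmf p)"
    using Suc inv by (intro nn_integral_mono_AE) (auto simp: AE_measure_pmf_iff node_states_Cons
        simp del: node_states.simps)
  also have "\<dots> = r ^ t * (\<integral>\<^sup>+e. \<Psi> (activate e S) \<partial>measure_pmf p)"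
    by (simp add: nn_integral_cmult)
  also have "\<dots> \<le> r ^ t * (r * \<Psi> S)"
    using drift Suc.prems by (intro mult_left_mono) auto
  finally show ?case
    by (simp add: ac_simps)
qed

text \<open>Every time before the first success is a failure, so the failures number at least the
  hitting time; without success the series is infinite.\<close>

lemma INF_enat_le_suminf:
  "ennreal_of_enat (INF t \<in> {t. P t}. enat t) \<le> (\<Sum>t. of_bool (\<not> P t))"
proof -
  have partial: "of_nat n \<le> (\<Sum>t. of_bool (\<not> P t) :: ennreal)" if "\<And>t. t < n \<Longrightarrow> \<not> P t" for n
  proof -
    have "of_nat n = (\<Sum>t<n. of_bool (\<not> P t) :: ennreal)"
      using that by simp
    also have "\<dots> \<le> (\<Sum>t. of_bool (\<not> P t))"
      by (intro sum_le_suminf) auto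
    finally show ?thesis .
  qed
  show ?thesis
  proof (cases "\<exists>t. P t")
    case True
    then have "P (LEAST t. P t)"
      by (rule LeastI_ex)
    then have "(INF t \<in> {t. P t}. enat t) \<le> enat (LEAST t. P t)"
      by (intro INF_lower) simp
    then have "ennreal_of_enat (INF t \<in> {t. P t}. enat t) \<le> of_nat (LEAST t. P t)"
      by (metis ennreal_of_enat_enat ennreal_of_enat_le_iff)
    also have "\<dots> \<le> (\<Sum>t. of_bool (\<not> P t))"
      by (intro partial) (rule not_less_Least)
    finally show ?thesis .
  next
    case False
    then have "of_nat n \<le> (\<Sum>t. of_bool (\<not> P t) :: ennreal)" for n
      using partial by blast
    then have "\<not> (\<exists>n. (\<Sum>t. of_bool (\<not> P t) :: ennreal) < of_nat n)"
      by (simp add: not_less)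
    then have "(\<Sum>t. of_bool (\<not> P t) :: ennreal) = top"
      using ennreal_Ex_less_of_nat less_top by blast
    then show ?thesis
      by simp
  qed
qed

text \<open>The first \<open>T\<close> terms are bounded by 1. Then \<open>M * (1 - \<delta>) ^ T
  \<le> M * exp (- (\<delta> * T)) \<le> 1\<close> leaves a geometric series of sum
  \<open>1 / \<delta>\<close>, so \<open>M\<close> enters only through its logarithm.\<close>

lemma suminf_truncated_geometric_le:
  fixes \<delta> M :: real and c :: "nat \<Rightarrow> ennreal"
  assumes "0 < \<delta>" "\<delta> \<le> 1" "1 \<le> M"
    and one: "\<And>t. c t \<le> 1" and geometric: "\<And>t. c t \<le> ennreal (M * (1 - \<delta>) ^ t)"
  shows "(\<Sum>t. c t) \<le> ennreal (ln M / \<delta> + 1 + 1 / \<delta>)"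
proof -
  define T where "T = nat \<lceil>ln M / \<delta>\<rceil>"
  have T: "ln M / \<delta> \<le> T" "T \<le> ln M / \<delta> + 1"
    using assms by (auto simp: T_def)
  have "(1 - \<delta>) ^ T \<le> exp (- \<delta>) ^ T"
    using assms exp_ge_add_one_self[of "- \<delta>"] by (intro power_mono) auto
  also have "\<dots> = exp (- (\<delta> * T))"
    by (simp flip: exp_of_nat_mult)
  also have "\<dots> \<le> exp (- ln M)"
    using T assms by (simp add: field_simps)
  also have "\<dots> = 1 / M"
    using assms by (simp add: exp_minus inverse_eq_divide)
  finally have M: "M * (1 - \<delta>) ^ T \<le> 1"
    using assms by (simp add: field_simps)
  have tail: "c (t + T) \<le> ennreal ((1 - \<delta>) ^ t)" for t
  proof -
    have "M * (1 - \<delta>) ^ (t + T) \<le> (1 - \<delta>) ^ t"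
      using mult_left_mono[OF M, of "(1 - \<delta>) ^ t"] assms by (simp add: power_add ac_simps)
    then show ?thesis
      using geometric[of "t + T"] by (meson ennreal_leI order_trans)
  qed
  have "(\<Sum>t. c t) = (\<Sum>t<T. c t) + (\<Sum>t. c (t + T))"
    using suminf_offset[of c T] by (simp add: add.commute)
  also have "\<dots> \<le> (\<Sum>t<T. 1) + (\<Sum>t. ennreal ((1 - \<delta>) ^ t))"
    using one tail by (intro add_mono sum_mono suminf_le) auto
  also have "(\<Sum>t. ennreal ((1 - \<delta>) ^ t)) = ennreal (\<Sum>t. (1 - \<delta>) ^ t)"
    using assms by (intro suminf_ennreal2 summable_geometric) auto
  also have "(\<Sum>t. (1 - \<delta>) ^ t) = 1 / \<delta>"
    using assms by (subst suminf_geometric) auto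
  also have "(\<Sum>t<T. 1) + ennreal (1 / \<delta>) = ennreal (T + 1 / \<delta>)"
    using assms by (simp add: ennreal_of_nat_eq_real_of_nat)
  also have "\<dots> \<le> ennreal (ln M / \<delta> + 1 + 1 / \<delta>)"
    using T by (intro ennreal_leI) simp
  finally show ?thesis .
qed

section \<open>The voting process on a connected graph\<close>

locale voting_graph =
  fixes \<G> :: "nat pair_pre_digraph" and N :: nat
  assumes graph: "pair_graph \<G>" and verts: "pverts \<G> = {1..N}" and N_ge_2: "N \<ge> 2"
    and conn: "Digraph_Component.connected (with_proj \<G>)"
begin

sublocale pair_graph \<G>
  by (rule graph)

lemma arcs_sub: "parcs \<G> \<subseteq> pverts \<G> \<times> pverts \<G>"
  by (auto dest: in_arcsD1 in_arcsD2)

lemma arcs_sym: "sym (parcs \<G>)"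
  using pair_sym_arcs by (simp add: symmetric_def)

lemma path_exists:
  assumes "x \<in> pverts \<G>" "y \<in> pverts \<G>"
  shows "(x, y) \<in> (parcs \<G>)\<^sup>*"
proof -
  have "strongly_connected (with_proj \<G>)"
    using symmetric_connected_imp_strongly_connected pair_sym_arcs conn by blast
  then have "(x, y) \<in> rtrancl_on (pverts \<G>) (parcs \<G>)"
    using assms by (auto simp: strongly_connected_def reachable_def)
  then show ?thesis
    by (rule rtrancl_on_rtranclI)
qed

lemma neighbors_eq: "neighbors \<G> i = parcs \<G> `` {i}"
  by (auto simp: neighbors_def)

lemma finite_neighbors: "finite (neighbors \<G> i)"
  unfolding neighbors_eq using pair_finite_arcs by (rule finite_Image)

text \<open>A second vertex exists, and a path to it leaves \<open>i\<close> by an arc; so the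
  uniform choice of a neighbour makes sense.\<close>

lemma neighbors_nonempty:
  assumes "i \<in> pverts \<G>"
  shows "neighbors \<G> i \<noteq> {}"
proof -
  have "1 \<in> pverts \<G>" "2 \<in> pverts \<G>"
    using N_ge_2 verts by auto
  then obtain j where j: "j \<in> pverts \<G>" "j \<noteq> i"
    by (cases "i = 1") auto
  then show ?thesis
    using path_exists[OF assms j(1)] by (auto simp: neighbors_def elim: converse_rtranclE)
qed

lemma pverts_nonempty: "pverts \<G> \<noteq> {}"
  using verts N_ge_2 by simp

lemma set_activation_pmf: "set_pmf (activation_pmf \<G>) = parcs \<G>"
proof -
  have "set_pmf (activation_pmf \<G>) = (\<Union>i\<in>pverts \<G>. Pair i ` neighbors \<G> i)"
    using pair_finite_verts pverts_nonempty finite_neighbors neighbors_nonempty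
    by (simp add: activation_pmf_def)
  also have "\<dots> = parcs \<G>"
    using arcs_sub by (auto simp: neighbors_def)
  finally show ?thesis .
qed

lemma pmf_activation_pmf:
  assumes "(i, j) \<in> parcs \<G>"
  shows "pmf (activation_pmf \<G>) (i, j) = 1 / (N * card (neighbors \<G> i))"
proof -
  have i: "i \<in> pverts \<G>"
    using assms arcs_sub by auto
  have j: "j \<in> neighbors \<G> i"
    using assms by (simp add: neighbors_def)
  have inner: "pmf (map_pmf (Pair k) (pmf_of_set (neighbors \<G> k))) (i, j)
      = (if k = i then 1 / card (neighbors \<G> i) else 0)" if "k \<in> pverts \<G>" for k
  proof (cases "k = i")
    case True
    have "inj (Pair i :: nat \<Rightarrow> _)"
      by (simp add: inj_def)
    then show ?thesis
      using True j finite_neighbors neighbors_nonempty[OF i] pmf_map_inj'[of "Pair i" _ j] by simp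
  next
    case False
    then have "(i, j) \<notin> set_pmf (map_pmf (Pair k) (pmf_of_set (neighbors \<G> k)))"
      by auto
    then show ?thesis
      using False by (simp add: pmf_eq_0_set_pmf)
  qed
  have "pmf (activation_pmf \<G>) (i, j)
      = (\<Sum>k\<in>pverts \<G>. pmf (map_pmf (Pair k) (pmf_of_set (neighbors \<G> k))) (i, j)) / card (pverts \<G>)"
    using pair_finite_verts pverts_nonempty
    by (simp add: activation_pmf_def pmf_bind_pmf_of_set)
  also have "(\<Sum>k\<in>pverts \<G>. pmf (map_pmf (Pair k) (pmf_of_set (neighbors \<G> k))) (i, j))
      = 1 / card (neighbors \<G> i)"
    using inner i pair_finite_verts by simp
  finally show ?thesis
    by (simp add: verts mult.commute)
qed

lemma card_pverts: "card (pverts \<G>) = N"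
  by (simp add: verts)

sublocale voting_swaps "pverts \<G>" "parcs \<G>" "pmf (activation_pmf \<G>)" "3 * real N ^ 2"
proof
  show "finite (pverts \<G>)" "pverts \<G> \<noteq> {}" "parcs \<G> \<subseteq> pverts \<G> \<times> pverts \<G>"
    by (fact pair_finite_verts pverts_nonempty arcs_sub)+
  show "sum (pmf (activation_pmf \<G>)) (parcs \<G>) = 1"
    using pair_finite_arcs by (intro sum_pmf_eq_1) (auto simp: set_activation_pmf)
  show "3 * real N ^ 2 > 0"
    using N_ge_2 by simp
  show "i \<noteq> j" if "(i, j) \<in> parcs \<G>" for i j
    using pair_no_loops[OF that] by simp
  show "(f x - f y)\<^sup>2 \<le> 3 * real N ^ 2 *
      (\<Sum>e\<in>parcs \<G>. pmf (activation_pmf \<G>) e * (f (fst e) - f (snd e))\<^sup>2)"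
    if "x \<in> pverts \<G>" "y \<in> pverts \<G>" for f x y
  proof -
    \<comment> \<open>The arc probabilities are the conductances of
      \<open>shortest_path_resistance\<close>.\<close>
    have "(\<Sum>e\<in>parcs \<G>. pmf (activation_pmf \<G>) e * (f (fst e) - f (snd e))\<^sup>2)
      = (\<Sum>e\<in>parcs \<G>. 1 / (card (pverts \<G>) * card (parcs \<G> `` {fst e})) * (f (fst e) - f (snd e))\<^sup>2)"
      by (intro sum.cong) (auto simp: pmf_activation_pmf neighbors_eq card_pverts)
    then show ?thesis
      using shortest_path_resistance[OF pair_finite_verts pverts_nonempty arcs_sub arcs_sym
          path_exists[OF that], of f]
      by (simp add: card_pverts)
  qed
qed simp_all

text \<open>Turns the contraction rate \<open>1 / (4 * G)\<close> into
  \<open>1 / (24 * real N ^ 3)\<close>.\<close>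

lemma G_eq: "G = 6 * real N ^ 3"
  unfolding G_def card_pverts by (simp add: power2_eq_square power3_eq_cube)

section \<open>Tail and expectation of the convergence time\<close>

lemma nn_integral_activation_pmf:
  assumes "\<And>e. f e \<ge> 0"
  shows "(\<integral>\<^sup>+e. ennreal (f e) \<partial>measure_pmf (activation_pmf \<G>))
    = ennreal (\<Sum>e\<in>parcs \<G>. pmf (activation_pmf \<G>) e * f e)"
  using assms pair_finite_arcs
  by (subst nn_integral_measure_pmf_finite)
     (simp_all add: set_activation_pmf sum_ennreal mult.commute flip: ennreal_mult)

lemma N_cube: "1 / (24 * real N ^ 3) > 0" "1 / (24 * real N ^ 3) \<le> 1"
proof -
  have "1 \<le> real N ^ 3"
    using N_ge_2 by (intro one_le_power) simp
  then have "1 \<le> 24 * real N ^ 3" and pos: "0 < 24 * real N ^ 3"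
    by linarith+
  then show "1 / (24 * real N ^ 3) > 0" "1 / (24 * real N ^ 3) \<le> 1"
    by (simp_all only: divide_le_eq_1_pos[OF pos] zero_less_divide_1_iff)
qed

text \<open>The potential is at least 1 before consensus, so its expectation dominates the
  probability, while it decays geometrically from a polynomial initial value.\<close>

lemma not_consensus_prob_le_pos:
  assumes S: "valid_state (pverts \<G>) S" "vote_margin (pverts \<G>) S > 0"
  shows "(\<integral>\<^sup>+\<omega>. of_bool (\<not> consensus (pverts \<G>) (node_states S \<omega> t)) \<partial>clock_space \<G>)
    \<le> ennreal (real N ^ 14 * (1 - 1 / (24 * real N ^ 3)) ^ t)"
proof -
  let ?V = "pverts \<G>"
  define r where "r = 1 - 1 / (24 * real N ^ 3)"
  have N: "real N \<ge> 2"
    using N_ge_2 by simp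
  have r: "r \<ge> 0"
    using N_cube by (simp add: r_def)
  obtain \<Psi> where \<Psi>: "\<And>S. 0 \<le> \<Psi> S"
    "\<And>S. \<Psi> S \<le> 2 * real N ^ 2 * (1 + 8 * real N ^ 2 * G)"
    "\<And>S. valid_state ?V S \<Longrightarrow> vote_margin ?V S > 0 \<Longrightarrow> \<not> consensus ?V S \<Longrightarrow> 1 \<le> \<Psi> S"
    "\<And>S. valid_state ?V S \<Longrightarrow> vote_margin ?V S > 0 \<Longrightarrow>
      (\<Sum>e\<in>parcs \<G>. pmf (activation_pmf \<G>) e * \<Psi> (activate e S)) \<le> r * \<Psi> S"
    using consensus_potential_exists unfolding card_pverts r_def G_eq by auto
  define I where "I S \<longleftrightarrow> valid_state ?V S \<and> vote_margin ?V S > 0" for S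
  define \<Phi> where "\<Phi> S = (if I S then ennreal (\<Psi> S) else 0)" for S
  have inv: "I (activate e S)" if "I S" "e \<in> set_pmf (activation_pmf \<G>)" for S e
  proof (cases e)
    case (Pair i j)
    then have "i \<in> ?V" "j \<in> ?V" "i \<noteq> j"
      using that arcs_sub loop_free by (auto simp: set_activation_pmf)
    then show ?thesis
      using that Pair pair_finite_verts
      by (simp add: I_def valid_state_activate vote_margin_activate)
  qed
  have drift: "(\<integral>\<^sup>+e. ennreal (\<Psi> (activate e S)) \<partial>measure_pmf (activation_pmf \<G>))
      \<le> ennreal r * ennreal (\<Psi> S)" if "I S" for S
    using \<Psi>(4)[of S] that r \<Psi>(1)
    by (simp add: nn_integral_activation_pmf I_def ennreal_leI flip: ennreal_mult)
  have AE_I: "AE \<omega> in clock_space \<G>. I (node_states S \<omega> t)"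
  proof -
    \<comment> \<open>The drift lemma with rate 1 for the indicator of leaving \<open>I\<close>,
      which starts at 0.\<close>
    have "(\<integral>\<^sup>+\<omega>. of_bool (\<not> I (node_states S \<omega> t)) \<partial>clock_space \<G>) \<le> 1 ^ t * of_bool (\<not> I S)"
      unfolding clock_space_def
    proof (rule nn_integral_node_states_le[where I = I])
      show "(\<integral>\<^sup>+e. of_bool (\<not> I (activate e S)) \<partial>measure_pmf (activation_pmf \<G>)) \<le> 1 * of_bool (\<not> I S)"
        if "I S" for S
        using that inv by (subst nn_integral_cong_AE[where v = "\<lambda>_. 0"]) (auto simp: AE_measure_pmf_iff)
    qed (use S inv in \<open>auto simp: I_def\<close>)
    then have "(\<integral>\<^sup>+\<omega>. of_bool (\<not> I (node_states S \<omega> t)) \<partial>clock_space \<G>) = (0 :: ennreal)"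
      using S by (simp add: I_def)
    moreover have "(\<lambda>\<omega>. of_bool (\<not> I (node_states S \<omega> t)) :: ennreal) \<in> borel_measurable (clock_space \<G>)"
      unfolding clock_space_def by (rule measurable_compose[OF measurable_node_states_stream]) simp
    ultimately show ?thesis
      by (simp add: nn_integral_0_iff_AE)
  qed
  have "(\<integral>\<^sup>+\<omega>. of_bool (\<not> consensus ?V (node_states S \<omega> t)) \<partial>clock_space \<G>)
      \<le> (\<integral>\<^sup>+\<omega>. ennreal (\<Psi> (node_states S \<omega> t)) \<partial>clock_space \<G>)"
  proof (rule nn_integral_mono_AE)
    show "AE \<omega> in clock_space \<G>.
        of_bool (\<not> consensus ?V (node_states S \<omega> t)) \<le> ennreal (\<Psi> (node_states S \<omega> t))"
      using AE_I by eventually_elim (use \<Psi>(3) in \<open>auto simp: I_def\<close>)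
  qed
  also have "\<dots> \<le> ennreal r ^ t * ennreal (\<Psi> S)"
    unfolding clock_space_def
    using S inv drift by (intro nn_integral_node_states_le[where I = I]) (auto simp: I_def)
  also have "\<dots> = ennreal (\<Psi> S * r ^ t)"
    using r \<Psi>(1) by (simp add: ennreal_power mult.commute flip: ennreal_mult)
  also have "\<dots> \<le> ennreal (real N ^ 14 * r ^ t)"
  proof (intro ennreal_leI mult_right_mono)
    \<comment> \<open>The initial bound \<open>2 * N ^ 2 + 96 * N ^ 7\<close> is at most
      \<open>2 ^ 7 * N ^ 7\<close>, hence at most \<open>N ^ 14\<close>, whose logarithm is
      \<open>14 * ln N\<close>.\<close>
    have "real N ^ 2 * 1 \<le> real N ^ 2 * real N ^ 5"
      using N by (intro mult_left_mono one_le_power) auto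
    then have "real N ^ 2 \<le> real N ^ 7"
      by (simp flip: power_add)
    moreover have "2 * real N ^ 2 * (1 + 8 * real N ^ 2 * G) = 2 * real N ^ 2 + 96 * real N ^ 7"
      by (simp add: G_eq algebra_simps flip: power_add)
    moreover have "0 \<le> real N ^ 7"
      by simp
    ultimately have "2 * real N ^ 2 * (1 + 8 * real N ^ 2 * G) \<le> 128 * real N ^ 7"
      by linarith
    also have "128 * real N ^ 7 = 2 ^ 7 * real N ^ 7"
      by simp
    also have "\<dots> \<le> real N ^ 7 * real N ^ 7"
      using N by (intro mult_right_mono power_mono) auto
    also have "\<dots> = real N ^ 14"
      by (simp flip: power_add)
    finally show "\<Psi> S \<le> real N ^ 14"
      using \<Psi>(2)[of S] by simp
  qed (use r in simp)
  finally show ?thesis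
    by (simp only: r_def)
qed

lemma node_states_uminus: "node_states (- S) \<omega> t = - node_states S \<omega> t"
  by (induction t) (simp_all only: node_states.simps activate_uminus)

text \<open>The dynamics commutes with reversing all signs, which preserves consensus and negates
  the margin.\<close>

lemma not_consensus_prob_le:
  assumes S: "valid_state (pverts \<G>) S" "vote_margin (pverts \<G>) S \<noteq> 0"
  shows "(\<integral>\<^sup>+\<omega>. of_bool (\<not> consensus (pverts \<G>) (node_states S \<omega> t)) \<partial>clock_space \<G>)
    \<le> ennreal (real N ^ 14 * (1 - 1 / (24 * real N ^ 3)) ^ t)"
proof (cases "vote_margin (pverts \<G>) S > 0")
  case True
  then show ?thesis
    using not_consensus_prob_le_pos S by blast
next
  case False
  have "consensus V (- T) \<longleftrightarrow> consensus V T" for V T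
    by (auto simp: consensus_def)
  moreover have "valid_state (pverts \<G>) (- S)"
    using S(1) by (force simp: valid_state_def)
  moreover have "vote_margin (pverts \<G>) (- S) = - vote_margin (pverts \<G>) S"
    unfolding vote_margin_def sum_negf[symmetric] by (intro sum.cong) (auto simp: strong_sign_def)
  ultimately show ?thesis
    using not_consensus_prob_le_pos[of "- S" t] False S(2) by (simp add: node_states_uminus)
qed

text \<open>Weak states have strong sign 0, so the margin depends on the votes alone, whatever the
  random weak states are.\<close>

lemma vote_margin_initial:
  assumes "\<forall>i\<in>pverts \<G>. S i \<in> initial_states (votes i)"
  shows "valid_state (pverts \<G>) S"
    and "vote_margin (pverts \<G>) S = int (card {i \<in> pverts \<G>. votes i = Vote_Pos})
      - int (card {i \<in> pverts \<G>. votes i = Vote_Neg})"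
proof -
  have S: "S i \<in> (case votes i of Vote_Pos \<Rightarrow> {2} | Vote_Neg \<Rightarrow> {-2} | No_Vote \<Rightarrow> {1, -1})"
    if "i \<in> pverts \<G>" for i
    using bspec[OF assms that] by (cases "votes i") auto
  show "valid_state (pverts \<G>) S"
    unfolding valid_state_def
  proof
    fix i assume "i \<in> pverts \<G>"
    from S[OF this] show "S i \<in> {2, -2, 1, -1}"
      by (auto split: vote.splits)
  qed
  have "strong_sign (S i) = of_bool (votes i = Vote_Pos) - of_bool (votes i = Vote_Neg)"
    if "i \<in> pverts \<G>" for i
    using S[OF that] by (auto simp: strong_sign_def split: vote.splits)
  then have "vote_margin (pverts \<G>) S
      = (\<Sum>i\<in>pverts \<G>. of_bool (votes i = Vote_Pos)) - (\<Sum>i\<in>pverts \<G>. of_bool (votes i = Vote_Neg))"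
    by (simp add: vote_margin_def sum_subtractf)
  then show "vote_margin (pverts \<G>) S = int (card {i \<in> pverts \<G>. votes i = Vote_Pos})
      - int (card {i \<in> pverts \<G>. votes i = Vote_Neg})"
    using pair_finite_verts by (simp add: sum_of_bool_eq Collect_conj_eq)
qed

lemma expected_convergence_time_le:
  assumes maj: "majority_exists (pverts \<G>) votes" and \<mu>: "initial_law (pverts \<G>) votes \<mu>"
  shows "expected_convergence_time \<G> \<mu> \<le> ennreal (408 * real N ^ 3 * ln (real N))"
proof -
  let ?V = "pverts \<G>" and ?\<Omega> = "measure_pmf \<mu> \<Otimes>\<^sub>M clock_space \<G>"
  define \<delta> where "\<delta> = 1 / (24 * real N ^ 3)"
  define c where "c t = (\<integral>\<^sup>+(S, \<omega>). of_bool (\<not> consensus ?V (node_states S \<omega> t)) \<partial>?\<Omega>)" for t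
  have [measurable]: "(\<lambda>(S, \<omega>). of_bool (\<not> consensus ?V (node_states S \<omega> t)) :: ennreal)
      \<in> borel_measurable ?\<Omega>" for t
    unfolding clock_space_def case_prod_beta
    by (rule measurable_compose[OF measurable_node_states_pair[unfolded case_prod_beta]]) simp
  interpret clock: prob_space "clock_space \<G>"
    unfolding clock_space_def
    by (intro prob_space.prob_space_stream_space prob_space_measure_pmf)
  \<comment> \<open>By Tonelli, a bound uniform over the initial configurations in the support
    passes to their mixture.\<close>
  have c_le: "c t \<le> b" if "\<And>S. S \<in> set_pmf \<mu> \<Longrightarrow>
      (\<integral>\<^sup>+\<omega>. of_bool (\<not> consensus ?V (node_states S \<omega> t)) \<partial>clock_space \<G>) \<le> b" for t b
  proof -
    have "c t = (\<integral>\<^sup>+S. \<integral>\<^sup>+\<omega>. of_bool (\<not> consensus ?V (node_states S \<omega> t)) \<partial>clock_space \<G> \<partial>measure_pmf \<mu>)"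
      unfolding c_def by (subst clock.nn_integral_fst[symmetric]) auto
    also have "\<dots> \<le> (\<integral>\<^sup>+S. b \<partial>measure_pmf \<mu>)"
      using that by (intro nn_integral_mono_AE) (auto simp: AE_measure_pmf_iff)
    finally show ?thesis
      by simp
  qed
  have one: "c t \<le> 1" for t
  proof (rule c_le)
    fix S
    have "(\<integral>\<^sup>+\<omega>. of_bool (\<not> consensus ?V (node_states S \<omega> t)) \<partial>clock_space \<G>)
        \<le> (\<integral>\<^sup>+\<omega>. 1 \<partial>clock_space \<G>)"
      by (intro nn_integral_mono) auto
    then show "(\<integral>\<^sup>+\<omega>. of_bool (\<not> consensus ?V (node_states S \<omega> t)) \<partial>clock_space \<G>) \<le> (1 :: ennreal)"
      by (simp add: clock.emeasure_space_1)
  qed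
  have geometric: "c t \<le> ennreal (real N ^ 14 * (1 - \<delta>) ^ t)" for t
  proof (rule c_le)
    fix S assume "S \<in> set_pmf \<mu>"
    then have "\<forall>i\<in>?V. S i \<in> initial_states (votes i)"
      using \<mu> by (simp add: initial_law_def)
    then show "(\<integral>\<^sup>+\<omega>. of_bool (\<not> consensus ?V (node_states S \<omega> t)) \<partial>clock_space \<G>)
        \<le> ennreal (real N ^ 14 * (1 - \<delta>) ^ t)"
      unfolding \<delta>_def using vote_margin_initial[of S votes] maj
      by (intro not_consensus_prob_le) (auto simp: majority_exists_def)
  qed
  have N: "real N \<ge> 2"
    using N_ge_2 by simp
  have \<delta>: "0 < \<delta>" "\<delta> \<le> 1"
    unfolding \<delta>_def by (fact N_cube)+
  have "expected_convergence_time \<G> \<mu>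
      \<le> (\<integral>\<^sup>+p. (\<Sum>t. case p of (S, \<omega>) \<Rightarrow> of_bool (\<not> consensus ?V (node_states S \<omega> t))) \<partial>?\<Omega>)"
    unfolding expected_convergence_time_def convergence_time_def case_prod_beta
    by (intro nn_integral_mono INF_enat_le_suminf)
  also have "\<dots> = (\<Sum>t. c t)"
    unfolding c_def by (intro nn_integral_suminf) measurable
  also have "\<dots> \<le> ennreal (ln (real N ^ 14) / \<delta> + 1 + 1 / \<delta>)"
    using N \<delta> one geometric by (intro suminf_truncated_geometric_le) (auto intro: one_le_power)
  \<comment> \<open>The leading constant is 336 = 14 * 24. The rest, at most
    \<open>25 * N ^ 3\<close>, is absorbed by \<open>72 * N ^ 3 * ln N\<close>, which is at least
    \<open>48 * N ^ 3\<close>.\<close>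
  also have "\<dots> \<le> ennreal (408 * real N ^ 3 * ln (real N))"
  proof (rule ennreal_leI)
    have "2 / 3 \<le> ln (real N)"
      using ln2_ge_two_thirds N by (meson ln_mono order_trans zero_less_numeral)
    then have "real N ^ 3 * (2 / 3) \<le> real N ^ 3 * ln (real N)"
      by (intro mult_left_mono) auto
    moreover have "ln (real N ^ 14) / \<delta> + 1 + 1 / \<delta>
        = 336 * (real N ^ 3 * ln (real N)) + 24 * real N ^ 3 + 1"
      using N by (simp add: \<delta>_def ln_realpow)
    moreover have "1 \<le> real N ^ 3"
      using N by (intro one_le_power) simp
    ultimately show "ln (real N ^ 14) / \<delta> + 1 + 1 / \<delta> \<le> 408 * real N ^ 3 * ln (real N)"
      by (simp only: mult.assoc)
  qed
  finally show ?thesis .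
qed

end

theorem theorem1:
  shows "\<exists>C::real. C > 0 \<and>
    (\<forall>(N::nat) (G::nat pair_pre_digraph) (votes::nat \<Rightarrow> vote) (\<mu>::(nat \<Rightarrow> int) pmf).
       N \<ge> 2 \<longrightarrow> pair_graph G \<longrightarrow> pverts G = {1..N} \<longrightarrow> Digraph_Component.connected (with_proj G) \<longrightarrow>
       majority_exists (pverts G) votes \<longrightarrow> initial_law (pverts G) votes \<mu> \<longrightarrow>
       expected_convergence_time G \<mu> \<le> ennreal (C * real N ^ 3 * ln (real N)))"
proof (intro exI[of _ 408] conjI allI impI)
  fix N :: nat and G votes \<mu>
  assume "N \<ge> 2" "pair_graph G" "pverts G = {1..N}" "Digraph_Component.connected (with_proj G)"
    and votes: "majority_exists (pverts G) votes" "initial_law (pverts G) votes \<mu>"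
  then interpret voting_graph G N
    by (intro voting_graph.intro)
  show "expected_convergence_time G \<mu> \<le> ennreal (408 * real N ^ 3 * ln (real N))"
    using votes by (rule expected_convergence_time_le)
qed simp

end
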